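(* Let $m_n$ denote the number of matroids with ground set $\{1,\ldots,n\}$. Then $$\log\log m_n \le n - \frac{3}{2}\log n + 2\log\log n + O(1)\qquad\text{as } n\to\infty.$$
   Context: $\log$ denotes the logarithm to base 2. Matroids are counted as labelled objects on the fixed ground set $\{1,\ldots,n\}$, not up to isomorphism. The term $O(1)$ denotes a function of $n$ that is bounded for all sufficiently large $n$. *)

theory Defs
  imports Complex_Main "HOL-Library.Landau_Symbols"
begin

locale matroid =
  fixes ground :: "'a set" and indep :: "'a set set"
  assumes ground_finite: "finite ground"
    and indep_subset_ground: "X \<in> indep \<Longrightarrow> X \<subseteq> ground"
    and indep_empty: "{} \<in> indep"
    and indep_subset: "Y \<in> indep \<Longrightarrow> X \<subseteq> Y \<Longrightarrow> X \<in> indep"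
    and indep_augment:
      "X \<in> indep \<Longrightarrow> Y \<in> indep \<Longrightarrow> card X < card Y \<Longrightarrow> \<exists>y\<in>Y - X. insert y X \<in> indep"

definition matroids_on :: "'a set \<Rightarrow> 'a set set set" where
  "matroids_on E = {indep. matroid E indep}"

lemma finite_matroids_on: "finite E \<Longrightarrow> finite (matroids_on E)"
  by (rule finite_subset[of _ "Pow (Pow E)"])
    (auto simp: matroids_on_def dest: matroid.indep_subset_ground)

definition num_matroids :: "nat \<Rightarrow> nat" where
  "num_matroids n = card (matroids_on {1..n})"

end

theory Submission
  imports Defs "HOL-Analysis.Convex" "HOL-Real_Asymp.Real_Asymp"
begin

text \<open>A matroid of rank \<open>r\<close> on \<open>n\<close> points is determined by its set of bases, a family of \<open>r\<close>-sets. There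
are \<open>2 ^ (n choose r)\<close> such families, and the point is that matroids are so dependent on their
minors of rank 2 that the exponent drops by a factor of order \<open>log n / n\<close>. Contracting a set \<open>T\<close>
of size \<open>r - 2\<close> leaves a matroid of rank 2 (or nothing), which is merely a partition of a subset of
the points into parallel classes; so only \<open>2 ^ O(n log n)\<close> contractions are possible, although
there are about \<open>n\<^sup>2 / 2\<close> pairs for moderate \<open>r\<close>
(\<open>card_exchangeable_pairs_le\<close>).

Shearer's entropy lemma, in the combinatorial form \<open>card_power_le_prod_card_traces\<close>, passes from the
local counts to a global one: the logarithm of the number of families, relative to the number
\<open>n choose r\<close> of their possible members, is at most the same ratio for the contractions, which is
of order \<open>n log n\<close> over \<open>(n - r + 2) choose 2\<close>. For \<open>r \<le> n / 2\<close> the latter is of order \<open>log n / n\<close>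
(\<open>log_card_set_families_le\<close>). For larger \<open>r\<close> the same argument applies to the complements
of the bases, that is, to the dual matroid, and the few extreme ranks contribute only \<open>2 ^ n\<close>
each (\<open>log_card_matroids_of_rank_le\<close>).

Summation over all ranks gives that \<open>log m\<^sub>n\<close> is at most of order \<open>log n / n\<close> times the middle
binomial coefficient, which is at most \<open>2 ^ n / sqrt n\<close>. The two denominators \<open>n\<close> and \<open>sqrt n\<close> make up
the term \<open>- 3 / 2 * log n\<close>.\<close>

section \<open>Set families and their traces\<close>

text \<open>Mahler's inequality. After division by the right-hand side, the AM-GM inequality bounds each of
the two terms by an arithmetic mean of fractions, and for every index the two fractions sum
to \<open>1\<close>.\<close>

lemma root_prod_add_le:
  fixes a b :: "'i \<Rightarrow> real"
  assumes "finite K" "K \<noteq> {}" and a: "\<And>j. j \<in> K \<Longrightarrow> 0 \<le> a j" and b: "\<And>j. j \<in> K \<Longrightarrow> 0 \<le> b j"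
  shows "root (card K) (\<Prod>j\<in>K. a j) + root (card K) (\<Prod>j\<in>K. b j)
    \<le> root (card K) (\<Prod>j\<in>K. a j + b j)"
proof (cases "\<exists>j\<in>K. a j + b j = 0")
  case True
  then obtain j where "j \<in> K" "a j = 0" "b j = 0"
    using a b by (metis add_nonneg_eq_0_iff)
  then have "(\<Prod>j\<in>K. a j) = 0" "(\<Prod>j\<in>K. b j) = 0" "(\<Prod>j\<in>K. a j + b j) = 0"
    using assms(1) by (force simp: prod_zero_iff)+
  then show ?thesis by (simp only: real_root_zero)
next
  case False
  then have pos: "0 < a j + b j" if "j \<in> K" for j
    using a[OF that] b[OF that] that by (metis add_nonneg_nonneg less_eq_real_def)
  have k: "0 < card K"
    using assms by (simp add: card_gt_0_iff)
  define R where "R = root (card K) (\<Prod>j\<in>K. a j + b j)"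
  have R: "0 < R"
    unfolding R_def using k pos by (auto intro: prod_pos)
  have quot: "root (card K) (\<Prod>j\<in>K. c j) / R \<le> (\<Sum>j\<in>K. c j / (a j + b j)) / card K"
    if "\<And>j. j \<in> K \<Longrightarrow> 0 \<le> c j" for c
  proof -
    have "root (card K) (\<Prod>j\<in>K. c j) / R = root (card K) (\<Prod>j\<in>K. c j / (a j + b j))"
      by (simp add: R_def real_root_divide prod_dividef)
    also have "\<dots> \<le> (\<Sum>j\<in>K. c j / (a j + b j)) / card K"
      using arith_geom_mean[OF assms(1,2), of "\<lambda>j. c j / (a j + b j)"] that pos k
      by (simp add: root_powr_inverse prod_nonneg divide_nonneg_pos sum_divide_distrib)
    finally show ?thesis .
  qed
  have "(\<Sum>j\<in>K. a j / (a j + b j)) / card K + (\<Sum>j\<in>K. b j / (a j + b j)) / card K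
      = (\<Sum>j\<in>K. (a j + b j) / (a j + b j)) / card K"
    by (simp only: add_divide_distrib sum.distrib)
  also have "(\<Sum>j\<in>K. (a j + b j) / (a j + b j)) = (\<Sum>j\<in>K. 1)"
    using less_imp_neq[OF pos] by (intro sum.cong) auto
  also have "(\<Sum>j\<in>K. 1) / real (card K) = 1"
    using k by simp
  finally have "root (card K) (\<Prod>j\<in>K. a j) / R + root (card K) (\<Prod>j\<in>K. b j) / R \<le> 1"
    using add_mono[OF quot[of a, OF a] quot[of b, OF b]] by simp
  then show ?thesis
    using R by (simp add: R_def[symmetric] field_simps)
qed

text \<open>Mahler's inequality in the form of the induction step for traces: \<open>p\<close> and \<open>q\<close> are the sizes of
the two halves of a set family, \<open>a\<close> and \<open>b\<close> those of their traces on the sets through the point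
that separates the halves, and \<open>c\<close> collects the traces on the remaining sets.\<close>

lemma power_add_le_prod_add:
  fixes a b :: "'i \<Rightarrow> real"
  assumes K: "finite K" "K \<noteq> {}"
    and a: "\<And>j. j \<in> K \<Longrightarrow> 0 \<le> a j" and b: "\<And>j. j \<in> K \<Longrightarrow> 0 \<le> b j"
    and "0 \<le> p" "0 \<le> q" "0 \<le> c"
    and p: "p ^ card K \<le> (\<Prod>j\<in>K. a j) * c" and q: "q ^ card K \<le> (\<Prod>j\<in>K. b j) * c"
  shows "(p + q) ^ card K \<le> (\<Prod>j\<in>K. a j + b j) * c"
proof -
  have k: "0 < card K"
    using K by (simp add: card_gt_0_iff)
  let ?r = "root (card K)"
  have "p \<le> ?r (\<Prod>j\<in>K. a j) * ?r c"
    using real_root_le_mono[OF k p] k \<open>0 \<le> p\<close> by (simp add: real_root_mult real_root_power_cancel)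
  moreover have "q \<le> ?r (\<Prod>j\<in>K. b j) * ?r c"
    using real_root_le_mono[OF k q] k \<open>0 \<le> q\<close> by (simp add: real_root_mult real_root_power_cancel)
  ultimately have "p + q \<le> (?r (\<Prod>j\<in>K. a j) + ?r (\<Prod>j\<in>K. b j)) * ?r c"
    by (simp add: algebra_simps)
  also have "\<dots> \<le> ?r (\<Prod>j\<in>K. a j + b j) * ?r c"
    using root_prod_add_le[OF K a b] k \<open>0 \<le> c\<close> by (intro mult_right_mono) auto
  finally have "(p + q) ^ card K \<le> (?r (\<Prod>j\<in>K. a j + b j) * ?r c) ^ card K"
    using \<open>0 \<le> p\<close> \<open>0 \<le> q\<close> by (intro power_mono) auto
  also have "\<dots> = (\<Prod>j\<in>K. a j + b j) * c"
    using k \<open>0 \<le> c\<close> a b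
    by (simp add: power_mult_distrib real_root_pow_pos2 prod_nonneg)
  finally show ?thesis .
qed

text \<open>The product theorem of Chung, Frankl, Graham and Shearer, the combinatorial form of Shearer's
entropy lemma. It goes by induction on the ground set: a point \<open>x\<close> splits the family into the
members without \<open>x\<close> and those with \<open>x\<close>. On a set \<open>A j\<close> through \<open>x\<close> the traces of the two halves
are different, so their numbers add up; on any other set the number of traces of each half is at
most the number of all traces. As exactly \<open>k\<close> of the sets contain \<open>x\<close>, Mahler's inequality with
\<open>k\<close> factors joins the two bounds.\<close>

lemma card_power_le_prod_card_traces:
  assumes "finite X" and J: "finite J" and k: "0 < k"
    and "\<And>x. x \<in> X \<Longrightarrow> card {j\<in>J. x \<in> A j} = k" and "\<F> \<subseteq> Pow X"
  shows "card \<F> ^ k \<le> (\<Prod>j\<in>J. card ((\<lambda>F. F \<inter> A j) ` \<F>))"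
  using assms(1,4,5)
proof (induction X arbitrary: \<F> rule: finite_induct)
  case empty
  show ?case
  proof (cases "\<F> = {}")
    case True
    then show ?thesis using k by (simp add: zero_power)
  next
    case False
    with empty have "\<F> = {{}}" by auto
    then show ?thesis by simp
  qed
next
  case (insert x X)
  let ?tr = "\<lambda>\<G> j. card ((\<lambda>F. F \<inter> A j) ` \<G>)"
  define F0 where "F0 = {F\<in>\<F>. x \<notin> F}"
  define F1 where "F1 = (\<lambda>F. F - {x}) ` {F\<in>\<F>. x \<in> F}"
  define K where "K = {j\<in>J. x \<in> A j}"
  have fin: "finite \<F>"
    using insert.prems(2) insert.hyps(1) by (meson finite.insertI finite_Pow_iff finite_subset)
  have K: "finite K" "card K = k" "K \<subseteq> J"
    using J insert.prems(1)[of x] by (auto simp: K_def)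
  then have "K \<noteq> {}" using k by auto
  have sub: "F0 \<subseteq> Pow X" "F1 \<subseteq> Pow X"
    using insert.prems(2) by (auto simp: F0_def F1_def)
  have "card F1 = card {F\<in>\<F>. x \<in> F}"
    unfolding F1_def by (intro card_image) (auto simp: inj_on_def)
  moreover have "card \<F> = card F0 + card {F\<in>\<F>. x \<in> F}"
    unfolding F0_def using fin by (subst card_Un_disjoint[symmetric]) (auto intro!: arg_cong[where f=card])
  ultimately have card: "card \<F> = card F0 + card F1" by simp
  have through: "?tr F0 j + ?tr F1 j \<le> ?tr \<F> j" if "j \<in> K" for j
  proof -
    have x: "x \<in> A j" using that by (simp add: K_def)
    let ?U = "(\<lambda>F. F \<inter> A j) ` F0" and ?V = "insert x ` (\<lambda>F. F \<inter> A j) ` F1"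
    have "?tr F1 j = card ?V"
    proof (rule card_image[symmetric])
      have "x \<notin> G" if "G \<in> (\<lambda>F. F \<inter> A j) ` F1" for G
        using that by (auto simp: F1_def)
      then show "inj_on (insert x) ((\<lambda>F. F \<inter> A j) ` F1)"
        by (intro inj_onI) (metis insert_ident)
    qed
    moreover have "?U \<inter> ?V = {}"
      by (auto simp: F0_def)
    moreover have "finite ?U" "finite ?V"
      using fin by (auto simp: F0_def F1_def)
    ultimately have "?tr F0 j + ?tr F1 j = card (?U \<union> ?V)"
      by (simp add: card_Un_disjoint)
    also have "?U \<union> ?V \<subseteq> (\<lambda>F. F \<inter> A j) ` \<F>"
    proof -
      have "insert x ((F - {x}) \<inter> A j) = F \<inter> A j" if "x \<in> F" for F
        using that x by auto
      then show ?thesis by (auto simp: F0_def F1_def)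
    qed
    then have "card (?U \<union> ?V) \<le> ?tr \<F> j"
      using fin by (intro card_mono) auto
    finally show ?thesis .
  qed
  have avoid: "?tr F0 j \<le> ?tr \<F> j" "?tr F1 j \<le> ?tr \<F> j" if "j \<in> J - K" for j
  proof -
    have "x \<notin> A j" using that by (simp add: K_def)
    then have "(F - {x}) \<inter> A j = F \<inter> A j" for F by auto
    then show "?tr F0 j \<le> ?tr \<F> j" "?tr F1 j \<le> ?tr \<F> j"
      using fin by (auto simp: F0_def F1_def intro!: card_mono)
  qed
  define c where "c = (\<Prod>j\<in>J - K. real (?tr \<F> j))"
  have split: "(\<Prod>j\<in>J. f j) = (\<Prod>j\<in>K. f j) * (\<Prod>j\<in>J - K. f j)" for f :: "_ \<Rightarrow> real"
    using prod.subset_diff[OF \<open>K \<subseteq> J\<close> J, of f] by (simp add: mult.commute)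
  have bound: "real (card \<G>) ^ k \<le> (\<Prod>j\<in>K. real (?tr \<G> j)) * c"
    if "\<G> \<subseteq> Pow X" and le: "\<And>j. j \<in> J - K \<Longrightarrow> ?tr \<G> j \<le> ?tr \<F> j" for \<G>
  proof -
    have "card \<G> ^ k \<le> (\<Prod>j\<in>J. ?tr \<G> j)"
      using insert.IH[OF insert.prems(1) that(1)] by simp
    then have "real (card \<G>) ^ k \<le> (\<Prod>j\<in>J. real (?tr \<G> j))"
      by (metis of_nat_le_iff of_nat_power of_nat_prod)
    also have "\<dots> \<le> (\<Prod>j\<in>K. real (?tr \<G> j)) * c"
      unfolding split c_def using le by (intro mult_left_mono prod_mono prod_nonneg) auto
    finally show ?thesis .
  qed
  have "real (card \<F>) ^ k \<le> (\<Prod>j\<in>K. real (?tr F0 j) + real (?tr F1 j)) * c"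
    unfolding card of_nat_add
    using bound[OF sub(1) avoid(1)] bound[OF sub(2) avoid(2)] K(1) \<open>K \<noteq> {}\<close>
    unfolding \<open>card K = k\<close>[symmetric]
    by (intro power_add_le_prod_add) (auto simp: c_def prod_nonneg)
  also have "\<dots> \<le> (\<Prod>j\<in>K. real (?tr \<F> j)) * c"
    using through by (intro mult_right_mono prod_mono) (auto simp: c_def prod_nonneg simp flip: of_nat_add)
  also have "\<dots> = (\<Prod>j\<in>J. real (?tr \<F> j))"
    by (simp add: split c_def)
  finally have "real (card \<F> ^ k) \<le> real (\<Prod>j\<in>J. ?tr \<F> j)"
    by (simp only: of_nat_power of_nat_prod)
  then show ?case
    by (simp only: of_nat_le_iff)
qed

section \<open>Families with rank-2 contractions\<close>

text \<open>The bases of a matroid of rank 2, where the empty family is admitted too: contracting a dependent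
set leaves no basis at all. The condition is that not being joined by a pair is a
transitive relation on the points that are covered; in this form it can be read off both from
contractions of bases and from contractions of complements of bases.\<close>

definition exchangeable_pairs :: "'a set set \<Rightarrow> bool" where
  "exchangeable_pairs G \<longleftrightarrow>
    (\<forall>C\<in>G. card C = 2) \<and> (\<forall>C\<in>G. \<forall>y\<in>\<Union>G. \<exists>x\<in>C. {x, y} \<in> G)"

text \<open>On the covered points, not being joined by a pair is an equivalence relation (its classes are the
parallel classes of the matroid). A family is therefore determined by the map that sends every
covered point to a representative of its class and every other point, a loop, to \<open>None\<close>.\<close>

lemma card_exchangeable_pairs_le:
  assumes "finite V"
  shows "card {G. G \<subseteq> Pow V \<and> exchangeable_pairs G} \<le> (card V + 1) ^ card V"
proof -
  define N where "N = V \<rightarrow>\<^sub>E insert None (Some ` V)"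
  define \<Phi> where "\<Phi> f = {{x, y} |x y. x \<in> V \<and> y \<in> V \<and> f x \<noteq> None \<and> f y \<noteq> None \<and> f x \<noteq> f y}"
    for f :: "'a \<Rightarrow> 'a option"
  have "G \<in> \<Phi> ` N" if "G \<subseteq> Pow V" and ex: "exchangeable_pairs G" for G
  proof -
    have two: "card C = 2" if "C \<in> G" for C
      using ex that by (simp add: exchangeable_pairs_def)
    \<comment> \<open>A pair \<open>{x, z}\<close> would have to exchange one of its points for \<open>y\<close>.\<close>
    have trans: "{x, z} \<notin> G"
      if "{x, y} \<notin> G" "{y, z} \<notin> G" "y \<in> \<Union>G" for x y z
    proof
      assume "{x, z} \<in> G"
      then obtain w where "w \<in> {x, z}" "{w, y} \<in> G"
        using ex \<open>y \<in> \<Union>G\<close> unfolding exchangeable_pairs_def by meson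
      then show False using that(1,2) by (auto simp: insert_commute)
    qed
    define rep where "rep y = (SOME z. z \<in> \<Union>G \<and> {z, y} \<notin> G)" for y
    have rep: "rep y \<in> \<Union>G" "{rep y, y} \<notin> G" if "y \<in> \<Union>G" for y
    proof -
      have "{y, y} \<notin> G" using two[of "{y, y}"] by auto
      then have "\<exists>z. z \<in> \<Union>G \<and> {z, y} \<notin> G" using that by blast
      from someI_ex[OF this] show "rep y \<in> \<Union>G" "{rep y, y} \<notin> G"
        by (auto simp: rep_def)
    qed
    have rep_eq: "rep x = rep y \<longleftrightarrow> {x, y} \<notin> G" if "x \<in> \<Union>G" "y \<in> \<Union>G" for x y
    proof
      assume "rep x = rep y"
      then show "{x, y} \<notin> G"
        using rep[OF that(1)] rep[OF that(2)] trans[of x "rep x" y] by (simp add: insert_commute)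
    next
      assume "{x, y} \<notin> G"
      then have "{z, x} \<notin> G \<longleftrightarrow> {z, y} \<notin> G" for z
        using trans[of z x y] trans[of z y x] that by (auto simp: insert_commute)
      then show "rep x = rep y" by (simp add: rep_def)
    qed
    define f where "f = restrict (\<lambda>y. if y \<in> \<Union>G then Some (rep y) else None) V"
    have "\<Union>G \<subseteq> V" using that(1) by auto
    then have "rep y \<in> V" if "y \<in> \<Union>G" for y
      using rep(1)[OF that] by blast
    then have "f \<in> N"
      unfolding f_def N_def restrict_PiE_iff by simp
    have f: "f y = (if y \<in> \<Union>G then Some (rep y) else None)" if "y \<in> V" for y
      using that by (simp add: f_def)
    have "C \<in> \<Phi> f" if "C \<in> G" for C
    proof -
      obtain x y where C: "C = {x, y}" using two[OF \<open>C \<in> G\<close>] by (auto simp: card_2_iff)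
      then have *: "x \<in> \<Union>G" "y \<in> \<Union>G" "rep x \<noteq> rep y" using \<open>C \<in> G\<close> rep_eq[of x y] by auto
      then have "x \<in> V" "y \<in> V" using \<open>\<Union>G \<subseteq> V\<close> by auto
      then show ?thesis
        unfolding \<Phi>_def C using * f[of x] f[of y] by (intro CollectI exI[of _ x] exI[of _ y]) simp
    qed
    moreover have "C \<in> G" if "C \<in> \<Phi> f" for C
    proof -
      obtain x y where C: "C = {x, y}" "x \<in> V" "y \<in> V" "f x \<noteq> None" "f y \<noteq> None" "f x \<noteq> f y"
        using \<open>C \<in> \<Phi> f\<close> unfolding \<Phi>_def by blast
      then have "x \<in> \<Union>G" "y \<in> \<Union>G" "rep x \<noteq> rep y"
        using f[of x] f[of y] by (auto split: if_splits)
      then show ?thesis using rep_eq[of x y] C(1) by simp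
    qed
    ultimately show ?thesis using \<open>f \<in> N\<close> by blast
  qed
  then have "card {G. G \<subseteq> Pow V \<and> exchangeable_pairs G} \<le> card (\<Phi> ` N)"
    using assms by (intro card_mono) (auto simp: N_def intro!: finite_PiE)
  also have "\<dots> \<le> card N"
    using assms by (intro card_image_le) (auto simp: N_def intro!: finite_PiE)
  also have "\<dots> = (card V + 1) ^ card V"
    using assms by (simp add: N_def card_funcsetE card_image)
  finally show ?thesis .
qed

text \<open>The product theorem is applied to the \<open>r\<close>-subsets of \<open>E\<close> as points. For every \<open>T\<close> of size \<open>r - 2\<close>
there is a set of the cover, consisting of the \<open>r\<close>-sets that contain \<open>T\<close>; the trace of a family on
it is the contraction of the family by \<open>T\<close>, a family of exchangeable pairs, and an \<open>r\<close>-set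
belongs to as many of these sets as it has subsets of size \<open>r - 2\<close>.\<close>

lemma card_set_families_le:
  assumes E: "finite E" "card E = n" and r: "2 \<le> r"
    and uniform: "\<And>F. F \<in> \<F> \<Longrightarrow> F \<subseteq> {B. B \<subseteq> E \<and> card B = r}"
    and exch: "\<And>F T. F \<in> \<F> \<Longrightarrow> T \<subseteq> E \<Longrightarrow> card T = r - 2 \<Longrightarrow>
      exchangeable_pairs ((\<lambda>B. B - T) ` {B\<in>F. T \<subseteq> B})"
  shows "card \<F> ^ (r choose (r - 2)) \<le> (n + 1) ^ (n * (n choose (r - 2)))"
proof -
  let ?J = "{T. T \<subseteq> E \<and> card T = r - 2}" and ?X = "{B. B \<subseteq> E \<and> card B = r}"
  have trace: "card ((\<lambda>F. F \<inter> {B. T \<subseteq> B}) ` \<F>) \<le> (n + 1) ^ n" if "T \<in> ?J" for T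
  proof -
    \<comment> \<open>Removing \<open>T\<close> loses no information about sets that contain \<open>T\<close>.\<close>
    let ?c = "(\<lambda>F. (\<lambda>B. B - T) ` F)"
    have "inj_on ?c (Pow {B. T \<subseteq> B})"
    proof (intro inj_on_image_Pow)
      show "inj_on (\<lambda>B. B - T) {B. T \<subseteq> B}" by (auto simp: inj_on_def)
    qed
    then have "inj_on ?c ((\<lambda>F. F \<inter> {B. T \<subseteq> B}) ` \<F>)"
      by (rule inj_on_subset) auto
    then have "card ((\<lambda>F. F \<inter> {B. T \<subseteq> B}) ` \<F>) = card (?c ` (\<lambda>F. F \<inter> {B. T \<subseteq> B}) ` \<F>)"
      by (rule card_image[symmetric])
    also have "?c ` (\<lambda>F. F \<inter> {B. T \<subseteq> B}) ` \<F> \<subseteq> {G. G \<subseteq> Pow E \<and> exchangeable_pairs G}"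
    proof clarify
      fix F assume F: "F \<in> \<F>"
      have "F \<inter> {B. T \<subseteq> B} = {B\<in>F. T \<subseteq> B}" by auto
      then show "?c (F \<inter> {B. T \<subseteq> B}) \<subseteq> Pow E \<and> exchangeable_pairs (?c (F \<inter> {B. T \<subseteq> B}))"
        using exch[OF F, of T] that uniform[OF F] by auto
    qed
    then have "card (?c ` (\<lambda>F. F \<inter> {B. T \<subseteq> B}) ` \<F>) \<le> card {G. G \<subseteq> Pow E \<and> exchangeable_pairs G}"
      using E(1) by (intro card_mono) auto
    also have "\<dots> \<le> (n + 1) ^ n"
      using card_exchangeable_pairs_le[OF E(1)] E(2) by simp
    finally show ?thesis .
  qed
  have "card {T\<in>?J. B \<in> {B. T \<subseteq> B}} = r choose (r - 2)" if "B \<in> ?X" for B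
  proof -
    have "{T\<in>?J. B \<in> {B. T \<subseteq> B}} = {T. T \<subseteq> B \<and> card T = r - 2}" using that by auto
    then show ?thesis
      using n_subsets[of B "r - 2"] that E(1) by (auto intro: finite_subset)
  qed
  then have "card \<F> ^ (r choose (r - 2)) \<le> (\<Prod>T\<in>?J. card ((\<lambda>F. F \<inter> {B. T \<subseteq> B}) ` \<F>))"
  proof (intro card_power_le_prod_card_traces[where X = ?X])
    show "\<F> \<subseteq> Pow ?X" using uniform by blast
  qed (use E(1) in auto)
  also have "\<dots> \<le> (\<Prod>T\<in>?J. (n + 1) ^ n)"
    using trace by (intro prod_mono) auto
  also have "\<dots> = (n + 1) ^ (n * (n choose (r - 2)))"
    using n_subsets[OF E(1), of "r - 2"] E(2) by (simp add: power_mult)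
  finally show ?thesis .
qed

text \<open>The exponents of the previous bound are compared by counting the pairs \<open>T \<subseteq> B\<close> in two ways, so
that \<open>log 2 (card \<F>)\<close> is at most \<open>n * log 2 (n + 1) * (n choose r)\<close> divided by
\<open>(n - r + 2) choose 2\<close>. Since \<open>r \<le> n / 2\<close>, the divisor is at least \<open>n\<^sup>2 / 8\<close>. This is where a large
rank would be harmful: for \<open>r\<close> close to \<open>n\<close> the divisor is bounded.\<close>

lemma log_card_set_families_le:
  assumes E: "finite E" "card E = n" and r: "2 \<le> r" "2 * r \<le> n"
    and uniform: "\<And>F. F \<in> \<F> \<Longrightarrow> F \<subseteq> {B. B \<subseteq> E \<and> card B = r}"
    and exch: "\<And>F T. F \<in> \<F> \<Longrightarrow> T \<subseteq> E \<Longrightarrow> card T = r - 2 \<Longrightarrow>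
      exchangeable_pairs ((\<lambda>B. B - T) ` {B\<in>F. T \<subseteq> B})"
  shows "log 2 (card \<F>) \<le> 8 * real (n choose r) * log 2 (real n + 1) / real n"
proof (cases "card \<F> = 0")
  case True
  then show ?thesis by (simp add: log_def)
next
  case False
  define d where "d = r choose (r - 2)"
  define e where "e = (n - r + 2) choose 2"
  define L where "L = log 2 (real n + 1)"
  have "d > 0" by (simp add: d_def)
  have n: "0 < n" using r by simp
  have "0 \<le> L" by (simp add: L_def)
  have de: "(n choose r) * d = (n choose (r - 2)) * e"
  proof -
    have "n - (r - 2) = n - r + 2" "r - (r - 2) = 2" "r - 2 \<le> r" "r \<le> n" using r by auto
    then show ?thesis using choose_mult[of "r - 2" r n] by (simp only: d_def e_def)
  qed
  have "real d * log 2 (card \<F>) = log 2 (real (card \<F> ^ d))"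
    using False by (simp add: log_nat_power)
  also have "\<dots> \<le> log 2 (real ((n + 1) ^ (n * (n choose (r - 2)))))"
    using card_set_families_le[OF E r(1) uniform exch] False unfolding d_def
    by (subst log_le_cancel_iff) (auto simp only: of_nat_le_iff of_nat_0_less_iff zero_less_power intro: zero_less_power)
  also have "\<dots> = n * (n choose (r - 2)) * L"
    by (simp add: log_nat_power L_def add.commute)
  finally have "real d * log 2 (card \<F>) * e \<le> n * (n choose (r - 2)) * L * e"
    by (intro mult_right_mono) auto
  also have "\<dots> = n * L * real ((n choose (r - 2)) * e)" by simp
  also have "\<dots> = d * (n * L * (n choose r))" unfolding de[symmetric] by simp
  finally have le: "log 2 (card \<F>) * e \<le> n * L * (n choose r)"
    using \<open>d > 0\<close> by (simp add: mult.assoc mult_le_cancel_left_pos)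
  have "real n ^ 2 / 8 \<le> e"
  proof -
    have "2 * e = (n - r + 2) * (n - r + 1)"
      using choose_two[of "n - r + 2"] by (simp add: e_def)
    then have "2 * real e = real (n - r + 2) * real (n - r + 1)"
      by (metis of_nat_mult of_nat_numeral)
    moreover have "real n / 2 * (real n / 2) \<le> real (n - r + 2) * real (n - r + 1)"
      using r by (intro mult_mono) auto
    ultimately show ?thesis by (simp add: power2_eq_square)
  qed
  then have "log 2 (card \<F>) * (real n ^ 2 / 8) \<le> log 2 (card \<F>) * e"
    using False by (intro mult_left_mono) (auto simp: zero_le_log_cancel_iff Suc_le_eq)
  with le have "log 2 (card \<F>) * (real n ^ 2 / 8) \<le> n * L * (n choose r)" by linarith
  then show ?thesis
    using n by (simp add: L_def field_simps power2_eq_square)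
qed

section \<open>Bases and cobases of matroids\<close>

definition indep_rank :: "'a set set \<Rightarrow> nat" where
  "indep_rank I = Max (card ` I)"

definition bases :: "'a set set \<Rightarrow> 'a set set" where
  "bases I = {B\<in>I. card B = indep_rank I}"

lemma card_2_other_element:
  assumes "card C = 2" "y \<in> C"
  obtains x where "C = {x, y}" "x \<noteq> y"
proof -
  obtain u v where "C = {u, v}" "u \<noteq> v" using assms(1) by (auto simp: card_2_iff)
  with assms(2) that[of u] that[of v] show ?thesis by (auto simp: insert_commute)
qed

context matroid
begin

lemma finite_indep: "finite indep"
  using ground_finite indep_subset_ground by (intro finite_subset[of indep "Pow ground"]) auto

lemma finite_indep_member: "X \<in> indep \<Longrightarrow> finite X"
  using ground_finite indep_subset_ground finite_subset by blast

lemma card_le_indep_rank: "X \<in> indep \<Longrightarrow> card X \<le> indep_rank indep"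
  unfolding indep_rank_def using finite_indep by (intro Max_ge) auto

lemma bases_nonempty: "bases indep \<noteq> {}"
proof -
  have "indep_rank indep \<in> card ` indep"
    unfolding indep_rank_def using finite_indep indep_empty by (intro Max_in) auto
  then show ?thesis by (auto simp: bases_def)
qed

lemma indep_rank_le_card_ground: "indep_rank indep \<le> card ground"
proof -
  obtain B where "B \<in> indep" "card B = indep_rank indep"
    using bases_nonempty by (auto simp: bases_def)
  then show ?thesis
    using card_mono[OF ground_finite indep_subset_ground[of B]] by simp
qed

lemma indep_iff_subset_basis: "X \<in> indep \<longleftrightarrow> (\<exists>B\<in>bases indep. X \<subseteq> B)"
proof
  assume X: "X \<in> indep"
  define S where "S = {Y\<in>indep. X \<subseteq> Y}"
  have S: "finite S" "S \<noteq> {}" using X finite_indep by (auto simp: S_def)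
  then have "Max (card ` S) \<in> card ` S" by (intro Max_in) auto
  then obtain B where B: "B \<in> S" "card B = Max (card ` S)" by auto
  have max: "card Y \<le> card B" if "Y \<in> S" for Y
    unfolding B(2) using that S(1) by (intro Max_ge) auto
  have "card B = indep_rank indep"
  proof (rule ccontr)
    assume "card B \<noteq> indep_rank indep"
    then have "card B < indep_rank indep"
      using card_le_indep_rank[of B] B by (auto simp: S_def)
    moreover obtain D where "D \<in> indep" "card D = indep_rank indep"
      using bases_nonempty by (auto simp: bases_def)
    ultimately obtain y where y: "y \<in> D - B" "insert y B \<in> indep"
      using indep_augment[of B D] B by (auto simp: S_def)
    then have "card (insert y B) \<le> card B"
      using max[of "insert y B"] B by (auto simp: S_def)
    then show False
      using y finite_indep_member[of B] B by (simp add: S_def)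
  qed
  then show "\<exists>B\<in>bases indep. X \<subseteq> B" using B by (auto simp: bases_def S_def)
qed (auto simp: bases_def intro: indep_subset)

text \<open>The exchange partner \<open>y\<close> may be \<open>x\<close> itself.\<close>

lemma basis_exchange:
  assumes "B \<in> bases indep" "D \<in> bases indep" "x \<in> B"
  obtains y where "y \<in> D" "y \<notin> B - {x}" "insert y (B - {x}) \<in> bases indep"
proof -
  have fin: "finite B" using assms finite_indep_member by (auto simp: bases_def)
  have "card B > 0" using fin assms(3) by (auto simp: card_gt_0_iff)
  then have card: "card (B - {x}) = indep_rank indep - 1" "indep_rank indep > 0"
    using assms(1,3) fin by (auto simp: bases_def)
  moreover have "B - {x} \<in> indep" using assms(1) by (auto simp: bases_def intro: indep_subset)
  ultimately obtain y where y: "y \<in> D - (B - {x})" "insert y (B - {x}) \<in> indep"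
    using indep_augment[of "B - {x}" D] assms(2) by (auto simp: bases_def)
  then have "card (insert y (B - {x})) = indep_rank indep"
    using card fin by (subst card_insert_disjoint) auto
  then show ?thesis using that y by (auto simp: bases_def)
qed

text \<open>Given a basis \<open>B \<supseteq> T\<close> and a basis \<open>D = T \<union> {w, y}\<close>, exchanging \<open>w\<close> with a point of \<open>B\<close> yields a
basis that consists of \<open>T\<close>, \<open>y\<close> and a point of \<open>B - T\<close>.\<close>

lemma exchangeable_pairs_contract_bases:
  assumes T: "card T + 2 = indep_rank indep" "finite T"
  shows "exchangeable_pairs ((\<lambda>B. B - T) ` {B\<in>bases indep. T \<subseteq> B})"
  unfolding exchangeable_pairs_def
proof (intro conjI ballI)
  let ?G = "(\<lambda>B. B - T) ` {B\<in>bases indep. T \<subseteq> B}"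
  have two: "card (B - T) = 2" if "B \<in> bases indep" "T \<subseteq> B" for B
    using that T by (simp add: bases_def card_Diff_subset)
  then show "card C = 2" if "C \<in> ?G" for C using that by auto
  fix C y assume "C \<in> ?G" "y \<in> \<Union>?G"
  then obtain B D where B: "B \<in> bases indep" "T \<subseteq> B" "C = B - T"
    and D: "D \<in> bases indep" "T \<subseteq> D" "y \<in> D - T" by auto
  obtain w where w: "D - T = {w, y}" "w \<noteq> y"
    using card_2_other_element[OF two[OF D(1,2)] D(3)] .
  then have D_eq: "D - {w} = insert y T" using D by auto
  obtain x where x: "x \<in> B" "x \<notin> insert y T" "insert x (insert y T) \<in> bases indep"
  proof (rule basis_exchange[OF D(1) B(1), of w])
    show "w \<in> D" using w by auto
  qed (use D_eq in auto)
  then have "{x, y} = insert x (insert y T) - T" using D(3) by auto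
  then show "\<exists>x\<in>C. {x, y} \<in> ?G" using x B(3) by (intro bexI[of _ x] image_eqI) auto
qed

text \<open>The corresponding fact for the dual matroid. It is obtained from the exchange of bases directly:
the cobasis \<open>ground - B\<close> receives a point \<open>y\<close> of \<open>B\<close> when the basis \<open>B\<close> exchanges \<open>y\<close> with a point
\<open>z\<close>, and \<open>z\<close> leaves the cobasis. As \<open>z\<close> comes from a basis \<open>D\<close> disjoint from \<open>T\<close>, the new cobasis
still contains \<open>T\<close>.\<close>

lemma exchangeable_pairs_contract_cobases:
  assumes T: "card T + 2 + indep_rank indep = card ground" "T \<subseteq> ground"
  shows "exchangeable_pairs ((\<lambda>B. B - T) ` {B \<in> (\<lambda>B. ground - B) ` bases indep. T \<subseteq> B})"
  unfolding exchangeable_pairs_def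
proof (intro conjI ballI)
  let ?G = "(\<lambda>B. B - T) ` {B \<in> (\<lambda>B. ground - B) ` bases indep. T \<subseteq> B}"
  have G: "ground - B - T \<in> ?G" if "B \<in> bases indep" "B \<inter> T = {}" for B
    using that T(2) by (intro imageI) auto
  have two: "card (ground - B - T) = 2" if "B \<in> bases indep" "T \<subseteq> ground - B" for B
  proof -
    have B: "B \<subseteq> ground" "card B = indep_rank indep"
      using that indep_subset_ground by (auto simp: bases_def)
    have "card (ground - B - T) = card ground - card B - card T"
      using that(2) B(1) T(2) ground_finite by (simp add: card_Diff_subset finite_subset)
    then show ?thesis using T(1) B(2) by simp
  qed
  then show "card C = 2" if "C \<in> ?G" for C using that by auto
  fix C y assume C: "C \<in> ?G" and "y \<in> \<Union>?G"
  then obtain B D where B: "B \<in> bases indep" "T \<subseteq> ground - B" "C = ground - B - T"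
    and D: "D \<in> bases indep" "T \<subseteq> ground - D" "y \<in> ground - D - T" by auto
  show "\<exists>x\<in>C. {x, y} \<in> ?G"
  proof (cases "y \<in> C")
    case True
    then obtain x where "C = {x, y}"
      using card_2_other_element two[OF B(1,2)] B(3) by metis
    then show ?thesis using C by auto
  next
    case False
    then have "y \<in> B" using B(3) D(3) by auto
    then obtain z where z: "z \<in> D" "z \<notin> B - {y}" "insert z (B - {y}) \<in> bases indep"
      using basis_exchange[OF B(1) D(1)] by blast
    have "z \<in> ground" using z(1) D(1) indep_subset_ground by (auto simp: bases_def)
    then have "z \<in> C" "z \<noteq> y" using z D B(3) by auto
    then obtain x where x: "C = {x, z}" "x \<noteq> z"
      using card_2_other_element two[OF B(1,2)] B(3) by metis
    have "ground - insert z (B - {y}) - T = {x, y}"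
      using x B(3) D(3) \<open>y \<in> B\<close> \<open>z \<noteq> y\<close> by auto
    moreover have "insert z (B - {y}) \<inter> T = {}"
      using \<open>z \<in> C\<close> B by auto
    ultimately have "{x, y} \<in> ?G" using G[OF z(3)] by simp
    then show ?thesis using x(1) by auto
  qed
qed

end

lemma inj_on_bases: "inj_on bases (matroids_on E)"
proof (rule inj_onI)
  fix I J assume "I \<in> matroids_on E" "J \<in> matroids_on E" "bases I = bases J"
  then show "I = J"
    using matroid.indep_iff_subset_basis[of E I] matroid.indep_iff_subset_basis[of E J]
    by (intro set_eqI) (simp add: matroids_on_def)
qed

definition matroids_of_rank :: "'a set \<Rightarrow> nat \<Rightarrow> 'a set set set" where
  "matroids_of_rank E r = {I\<in>matroids_on E. indep_rank I = r}"

text \<open>For \<open>2 \<le> r \<le> n / 2\<close> the matroids are counted by their bases, for \<open>n / 2 \<le> r \<le> n - 2\<close> by the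
complements of their bases, which are families of sets of size \<open>n - r \<le> n / 2\<close>. In the extreme
ranks there are at most \<open>n\<close> sets of size \<open>r\<close>, hence at most \<open>2 ^ n\<close> families of them; the summand
\<open>n\<close> pays for these.\<close>

lemma log_card_matroids_of_rank_le:
  assumes E: "finite E" "card E = n" "0 < n" and r: "r \<le> n"
  shows "log 2 (card (matroids_of_rank E r)) \<le> n + 8 * real (n choose r) * log 2 (real n + 1) / real n"
proof -
  let ?M = "matroids_of_rank E r" and ?R = "8 * real (n choose r) * log 2 (real n + 1) / real n"
  have M: "matroid E I" "indep_rank I = r" if "I \<in> ?M" for I
    using that by (auto simp: matroids_of_rank_def matroids_on_def)
  have inj: "inj_on bases ?M"
    using inj_on_bases[of E] by (rule inj_on_subset) (auto simp: matroids_of_rank_def)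
  have bases: "bases I \<subseteq> {B. B \<subseteq> E \<and> card B = r}" if "I \<in> ?M" for I
    using matroid.indep_subset_ground[OF M(1)[OF that]] M(2)[OF that] by (auto simp: bases_def)
  have nonneg: "0 \<le> ?R" by simp
  consider "r \<le> 1 \<or> n \<le> r + 1" | "2 \<le> r" "2 * r \<le> n" | "2 \<le> n - r" "2 * (n - r) \<le> n"
    using r by arith
  then show ?thesis
  proof cases
    case 1
    then consider "r = 0" | "r = 1" | "r = n" | "n = Suc r"
      using r by linarith
    then have choose: "n choose r \<le> n"
      using E(3) by cases auto
    have "card ?M = card (bases ` ?M)" using inj by (rule card_image[symmetric])
    also have "\<dots> \<le> card (Pow {B. B \<subseteq> E \<and> card B = r})"
    proof (intro card_mono)
      show "bases ` ?M \<subseteq> Pow {B. B \<subseteq> E \<and> card B = r}" using bases by blast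
    qed (use E(1) in simp)
    also have "\<dots> = 2 ^ (n choose r)"
      using E by (simp add: card_Pow n_subsets)
    finally have "real (card ?M) \<le> 2 ^ (n choose r)"
      by (metis of_nat_le_iff of_nat_numeral of_nat_power)
    then have "log 2 (card ?M) \<le> n choose r"
      by (cases "card ?M = 0") (auto simp: log_le_iff powr_realpow log_def[of 2 0])
    then show ?thesis using nonneg choose by linarith
  next
    case 2
    have "log 2 (card (bases ` ?M)) \<le> ?R"
    proof (rule log_card_set_families_le[OF E(1,2) 2])
      show "F \<subseteq> {B. B \<subseteq> E \<and> card B = r}" if "F \<in> bases ` ?M" for F
        using that bases by blast
      show "exchangeable_pairs ((\<lambda>B. B - T) ` {B\<in>F. T \<subseteq> B})"
        if "F \<in> bases ` ?M" "T \<subseteq> E" "card T = r - 2" for F T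
      proof -
        obtain I where "I \<in> ?M" "F = bases I" using \<open>F \<in> bases ` ?M\<close> by blast
        then show ?thesis
          using matroid.exchangeable_pairs_contract_bases[of E I T] M[of I] 2 E that
          by (simp add: finite_subset)
      qed
    qed
    then show ?thesis
      using card_image[OF inj] by simp
  next
    case 3
    let ?c = "\<lambda>F. (\<lambda>B. E - B) ` F"
    have "inj_on ?c (bases ` ?M)"
    proof (rule inj_on_subset)
      show "inj_on ?c (Pow (Pow E))"
        by (intro inj_on_image_Pow) (auto simp: inj_on_def)
      show "bases ` ?M \<subseteq> Pow (Pow E)" using bases by blast
    qed
    then have inj': "inj_on (\<lambda>I. ?c (bases I)) ?M"
      using comp_inj_on[OF inj, of ?c] by (simp add: o_def)
    have "log 2 (card ((\<lambda>I. ?c (bases I)) ` ?M)) \<le> 8 * real (n choose (n - r)) * log 2 (real n + 1) / real n"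
    proof (rule log_card_set_families_le[OF E(1,2) 3])
      show "F \<subseteq> {B. B \<subseteq> E \<and> card B = n - r}" if F: "F \<in> (\<lambda>I. ?c (bases I)) ` ?M" for F
      proof -
        obtain I where I: "I \<in> ?M" "F = ?c (bases I)" using F by blast
        have "card (E - B) = n - r" if "B \<subseteq> E" "card B = r" for B
          using that E by (simp add: card_Diff_subset finite_subset)
        then show ?thesis unfolding I(2) using bases[OF I(1)] by blast
      qed
      show "exchangeable_pairs ((\<lambda>B. B - T) ` {B\<in>F. T \<subseteq> B})"
        if F: "F \<in> (\<lambda>I. ?c (bases I)) ` ?M" and T: "T \<subseteq> E" "card T = n - r - 2" for F T
      proof -
        obtain I where "I \<in> ?M" "F = ?c (bases I)" using F by blast
        then show ?thesis
          using matroid.exchangeable_pairs_contract_cobases[of E I T] M[of I] 3 E T r by simp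
      qed
    qed
    then show ?thesis
      using card_image[OF inj'] binomial_symmetric[OF r] by simp
  qed
qed

lemma log_num_matroids_le:
  assumes "0 < n"
  shows "log 2 (num_matroids n) \<le> log 2 (real n + 1) + n + 8 * real (n choose (n div 2)) * log 2 (real n + 1) / real n"
proof -
  let ?E = "{1..n}"
  define R where "R = n + 8 * real (n choose (n div 2)) * log 2 (real n + 1) / real n"
  have "card (matroids_of_rank ?E r) \<le> 2 powr R" if "r \<le> n" for r
  proof (cases "card (matroids_of_rank ?E r) = 0")
    case False
    have "log 2 (card (matroids_of_rank ?E r)) \<le> n + 8 * real (n choose r) * log 2 (real n + 1) / real n"
      using that assms by (intro log_card_matroids_of_rank_le) auto
    also have "\<dots> \<le> R"
      unfolding R_def using binomial_maximum[of n r]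
      by (intro add_left_mono divide_right_mono mult_right_mono mult_left_mono) auto
    finally show ?thesis using False by (simp add: log_le_iff)
  qed simp
  then have "(\<Sum>r\<le>n. real (card (matroids_of_rank ?E r))) \<le> (\<Sum>r\<le>n. 2 powr R)"
    by (intro sum_mono) auto
  moreover have "matroids_on ?E = (\<Union>r\<le>n. matroids_of_rank ?E r)"
    using matroid.indep_rank_le_card_ground[of ?E] by (auto simp: matroids_of_rank_def matroids_on_def)
  then have "num_matroids n \<le> (\<Sum>r\<le>n. card (matroids_of_rank ?E r))"
    unfolding num_matroids_def by (simp add: card_UN_le)
  then have "real (num_matroids n) \<le> (\<Sum>r\<le>n. real (card (matroids_of_rank ?E r)))"
    by (metis of_nat_le_iff of_nat_sum)
  ultimately have le: "num_matroids n \<le> (n + 1) * 2 powr R" by (simp add: add.commute)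
  show ?thesis
  proof (cases "num_matroids n = 0")
    case True
    then show ?thesis by (simp add: log_def)
  next
    case False
    then have "log 2 (num_matroids n) \<le> log 2 ((n + 1) * 2 powr R)"
      using le by simp
    also have "\<dots> = log 2 (real n + 1) + R"
      by (simp add: log_mult add.commute)
    finally show ?thesis by (simp add: R_def add.assoc)
  qed
qed

text \<open>The outer logarithm of \<open>log 2 (log 2 (num_matroids n))\<close> is monotone only on positive arguments,
so \<open>num_matroids n > 1\<close> has to be known.\<close>

lemma two_le_num_matroids:
  assumes "1 \<le> n"
  shows "2 \<le> num_matroids n"
proof -
  have "matroid {1..n} {{}}" "matroid {1..n} {{}, {1}}"
    using assms by unfold_locales (auto simp: subset_singleton_iff)
  then have "{{{}}, {{}, {1}}} \<subseteq> matroids_on {1..n}"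
    by (auto simp: matroids_on_def)
  then have "card {{{}}, {{}, {1::nat}}} \<le> num_matroids n"
    unfolding num_matroids_def by (intro card_mono finite_matroids_on) auto
  moreover have "{{}} \<noteq> {{}, {1::nat}}" by auto
  ultimately show ?thesis by simp
qed

section \<open>Middle binomial coefficients\<close>

text \<open>From \<open>k\<close> to \<open>k + 1\<close> the left-hand side grows by the factor
\<open>4 * (2 * k + 1) * (2 * k + 3) / (k + 1)\<^sup>2\<close>, which is less than \<open>16\<close>; the factor \<open>2 * k + 1\<close> in the
statement is chosen for this.\<close>

lemma central_binomial_square_le: "((2 * k) choose k)\<^sup>2 * (2 * k + 1) \<le> 16 ^ k"
proof (induction k)
  case (Suc k)
  let ?b = "(2 * k) choose k"
  have eq: "Suc k * ((2 * Suc k) choose Suc k) = 2 * (2 * k + 1) * ?b"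
  proof -
    have "Suc k * ((2 * k + 1) choose Suc k) = (2 * k + 1) * ?b"
      using binomial_absorption[of k "2 * k + 1"] by simp
    moreover have "(2 * Suc k) choose Suc k = 2 * ((2 * k + 1) choose Suc k)"
      using binomial_symmetric[of k "2 * k + 1"] by simp
    moreover have "Suc k * (2 * m) = 2 * (Suc k * m)" for m by simp
    ultimately show ?thesis by (simp only: mult.assoc)
  qed
  have "(Suc k)\<^sup>2 * (((2 * Suc k) choose Suc k)\<^sup>2 * (2 * Suc k + 1))
      = 4 * ((2 * k + 1) * (2 * k + 3)) * (?b\<^sup>2 * (2 * k + 1))"
  proof -
    have "2 * Suc k + 1 = 2 * k + 3" by simp
    then have "(Suc k)\<^sup>2 * (((2 * Suc k) choose Suc k)\<^sup>2 * (2 * Suc k + 1))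
      = (Suc k * ((2 * Suc k) choose Suc k))\<^sup>2 * (2 * k + 3)"
      by (simp only: power_mult_distrib mult.assoc)
    also have "\<dots> = (2 * (2 * k + 1) * ?b)\<^sup>2 * (2 * k + 3)"
      by (simp only: eq)
    also have "\<dots> = 4 * ((2 * k + 1) * (2 * k + 3)) * (?b\<^sup>2 * (2 * k + 1))"
    proof -
      have "(2 * a * b)\<^sup>2 * c = 4 * (a * c) * (b\<^sup>2 * a)" for a b c :: nat
        by (simp add: power2_eq_square)
      then show ?thesis .
    qed
    finally show ?thesis .
  qed
  also have "\<dots> \<le> (16 * (Suc k)\<^sup>2) * 16 ^ k"
    by (rule mult_mono[OF _ Suc.IH]) (auto simp: power2_eq_square algebra_simps)
  finally show ?case by (simp add: mult.assoc mult.left_commute)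
qed simp

lemma binomial_middle_le: "real (n choose (n div 2)) \<le> 2 ^ n / sqrt (real n + 1)"
proof -
  have sq: "(n choose (n div 2))\<^sup>2 * (n + 1) \<le> 4 ^ n"
  proof (cases "even n")
    case True
    then obtain k where "n = 2 * k" by auto
    then show ?thesis using central_binomial_square_le[of k] by (simp add: power_mult)
  next
    case False
    then obtain k where k: "n = 2 * k + 1" by (auto elim: oddE)
    \<comment> \<open>The middle coefficient of an odd row is half the central one of the next row.\<close>
    have "(2 * Suc k) choose Suc k = 2 * (n choose k)"
      using binomial_symmetric[of k "2 * k + 1"] k by simp
    then have "(2 * (n choose k))\<^sup>2 * (2 * Suc k + 1) \<le> 16 ^ Suc k"
      using central_binomial_square_le[of "Suc k"] by (simp only:)
    then have "4 * ((n choose k)\<^sup>2 * (n + 2)) \<le> 16 * 16 ^ k"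
      using k by (simp only: power_mult_distrib) simp
    then have "(n choose k)\<^sup>2 * (n + 1) \<le> 4 * 16 ^ k" by simp
    then show ?thesis using k by (simp add: power_mult)
  qed
  have "(real (n choose (n div 2)) * sqrt (n + 1))\<^sup>2 = real ((n choose (n div 2))\<^sup>2 * (n + 1))"
    by (simp add: power_mult_distrib algebra_simps)
  also have "\<dots> \<le> real (4 ^ n)" using sq by (simp only: of_nat_le_iff)
  also have "\<dots> = (2 ^ n)\<^sup>2" by (simp add: power_mult[symmetric] power2_eq_square power_mult_distrib[symmetric])
  finally have "real (n choose (n div 2)) * sqrt (n + 1) \<le> 2 ^ n"
    by (rule power2_le_imp_le) simp
  then show ?thesis by (simp add: field_simps)
qed

section \<open>Asymptotics\<close>

theorem theorem5:
  "\<exists>h :: nat \<Rightarrow> real. h \<in> O(\<lambda>_. 1) \<and>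
     (\<forall>\<^sub>F n in sequentially.
        log 2 (log 2 (real (num_matroids n)))
          \<le> real n - 3 / 2 * log 2 (real n) + 2 * log 2 (log 2 (real n)) + h n)"
proof (intro exI conjI)
  show "(\<lambda>n::nat. 4 :: real) \<in> O(\<lambda>_. 1)" by simp
  \<comment> \<open>The last summand has leading coefficient \<open>8\<close>; doubling it absorbs all the rest, and
      \<open>log 2 16 = 4\<close> is the constant \<open>h\<close>.\<close>
  have "\<forall>\<^sub>F n::nat in sequentially. log 2 (real n + 1) + real n + 8 * (2 ^ n / sqrt (real n + 1)) * log 2 (real n + 1) / real n
      \<le> 16 * (2 powr real n * real n powr (- 3 / 2) * log 2 (real n))"
    by real_asymp
  moreover have "\<forall>\<^sub>F n::nat in sequentially. 4 \<le> n" by (rule eventually_ge_at_top)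
  ultimately show "\<forall>\<^sub>F n in sequentially.
        log 2 (log 2 (real (num_matroids n)))
          \<le> real n - 3 / 2 * log 2 (real n) + 2 * log 2 (log 2 (real n)) + 4"
  proof eventually_elim
    case (elim n)
    have n: "0 < real n" "2 \<le> log 2 (real n)"
      using elim(2) by (auto simp: le_log_iff)
    have "log 2 2 \<le> log 2 (real (num_matroids n))"
      using two_le_num_matroids[of n] elim(2) by (subst log_le_cancel_iff) auto
    then have pos: "0 < log 2 (real (num_matroids n))" by simp
    have "log 2 (num_matroids n) \<le> log 2 (real n + 1) + n + 8 * real (n choose (n div 2)) * log 2 (real n + 1) / real n"
      using elim(2) by (intro log_num_matroids_le) simp
    also have "\<dots> \<le> log 2 (real n + 1) + n + 8 * (2 ^ n / sqrt (real n + 1)) * log 2 (real n + 1) / real n"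
      using binomial_middle_le[of n]
      by (intro add_left_mono divide_right_mono mult_right_mono mult_left_mono) auto
    also have "\<dots> \<le> 16 * (2 powr real n * real n powr (- 3 / 2) * log 2 (real n))"
      using elim(1) by (simp add: add.commute)
    finally have "log 2 (log 2 (num_matroids n)) \<le> log 2 (16 * (2 powr real n * real n powr (- 3 / 2) * log 2 (real n)))"
      using pos n by (subst log_le_cancel_iff) auto
    also have "\<dots> = log 2 (2 ^ 4) + (real n - 3 / 2 * log 2 (real n) + log 2 (log 2 (real n)))"
      using n by (simp add: log_mult log_powr)
    also have "log 2 ((2::real) ^ 4) = 4" by (subst log_pow_cancel) auto
    also have "4 + (real n - 3 / 2 * log 2 (real n) + log 2 (log 2 (real n)))
        \<le> real n - 3 / 2 * log 2 (real n) + 2 * log 2 (log 2 (real n)) + 4"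
      using n(2) by (simp add: zero_le_log_cancel_iff)
    finally show ?case by simp
  qed
qed

end
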